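(* Let $A$ be an admissible set of addition chains. The order type of $\mathscr{D}^A\cap[0,1]$ is $\omega$, while for any real $r<1$ the set $\mathscr{D}^A\cap[0,r]$ is finite. Furthermore, every defect in $\mathscr{D}^A\cap[0,1]$ is $A$-stable, and so the order type of $\mathscr{D}^A_{st}\cap[0,1]$ is $\omega$.
   Context: An addition chain for a positive integer $n$ is a sequence $(a_0,\ldots,a_r)$ with $a_0=1$, $a_r=n$, and for every $1\le k\le r$ there exist $0\le i,j<k$ with $a_k=a_i+a_j$; $r$ is its length. For a set $A$ of addition chains, $\ell^A(n)$ is the least length of an addition chain for $n$ belonging to $A$. $\nu_2(n)$ is the number of $1$'s in the binary expansion of $n$. $A$ is admissible if (i) for every $n\ge1$, $\ell^A(n)$ is defined and $\ell^A(n)\le\lfloor\log_2 n\rfloor+\nu_2(n)-1$, and (ii) for every $n\ge1$, $\ell^A(2n)\le\ell^A(n)+1$. The $A$-defect is $\delta^A(n)=\ell^A(n)-\log_2 n$, and $\mathscr{D}^A=\{\delta^A(n):n\ge1\}$. A positive integer $m$ is $A$-stable if $\ell^A(2^k m)=\ell^A(m)+k$ for all $k\ge0$; a defect is $A$-stable if it equals $\delta^A(m)$ for some $A$-stable $m$, and $\mathscr{D}^A_{st}$ is the set of $A$-stable defects. *)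

theory Defs
  imports Complex_Main
begin

text \<open>A chain \<open>(a\<^sub>0, \<dots>, a\<^sub>r)\<close> is the list of its \<open>r + 1\<close> entries;
  it need not be increasing.\<close>

definition addition_chain :: "nat list \<Rightarrow> bool" where
  "addition_chain c \<longleftrightarrow> c \<noteq> [] \<and> hd c = 1 \<and>
     (\<forall>k. 1 \<le> k \<and> k < length c \<longrightarrow> (\<exists>i<k. \<exists>j<k. c ! k = c ! i + c ! j))"

definition addition_chain_for :: "nat \<Rightarrow> nat list \<Rightarrow> bool" where
  "addition_chain_for n c \<longleftrightarrow> addition_chain c \<and> last c = n"

definition chain_length :: "nat list \<Rightarrow> nat" where
  "chain_length c = length c - 1"

definition ell_defined :: "nat list set \<Rightarrow> nat \<Rightarrow> bool" where
  "ell_defined A n \<longleftrightarrow> (\<exists>c\<in>A. addition_chain_for n c)"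

text \<open>Meaningful only when \<open>ell_defined A n\<close> holds; otherwise the value is unspecified.\<close>

definition ell :: "nat list set \<Rightarrow> nat \<Rightarrow> nat" where
  "ell A n = (LEAST r. \<exists>c\<in>A. addition_chain_for n c \<and> chain_length c = r)"

definition nu2 :: "nat \<Rightarrow> nat" where
  "nu2 n = card {i. bit n i}"

definition admissible :: "nat list set \<Rightarrow> bool" where
  "admissible A \<longleftrightarrow>
     (\<forall>n\<ge>1. ell_defined A n \<and> int (ell A n) \<le> \<lfloor>log 2 (real n)\<rfloor> + int (nu2 n) - 1) \<and>
     (\<forall>n\<ge>1. ell A (2 * n) \<le> ell A n + 1)"

definition defect :: "nat list set \<Rightarrow> nat \<Rightarrow> real" where
  "defect A n = real (ell A n) - log 2 (real n)"

definition defects :: "nat list set \<Rightarrow> real set" where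
  "defects A = {defect A n | n. n \<ge> 1}"

definition stable :: "nat list set \<Rightarrow> nat \<Rightarrow> bool" where
  "stable A m \<longleftrightarrow> m \<ge> 1 \<and> (\<forall>k. ell A (2 ^ k * m) = ell A m + k)"

definition stable_defect :: "nat list set \<Rightarrow> real \<Rightarrow> bool" where
  "stable_defect A d \<longleftrightarrow> (\<exists>m. stable A m \<and> d = defect A m)"

definition stable_defects :: "nat list set \<Rightarrow> real set" where
  "stable_defects A = {d. stable_defect A d}"

text \<open>\<^const>\<open>ordIso\<close> relates well-orders only, so this includes that \<open>S\<close> is
  well-ordered by the usual order; \<^const>\<open>natLeq\<close> is the library's \<open>\<omega>\<close>.\<close>

definition order_type_omega :: "real set \<Rightarrow> bool" where
  "order_type_omega S \<longleftrightarrow> ({(x, y). x \<in> S \<and> y \<in> S \<and> x \<le> y}, natLeq) \<in> ordIso"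

end

theory Submission
  imports Defs
begin

text \<open>An entry \<open>a\<^sub>s\<close> of a chain is at most \<open>2\<^sup>s\<close>, and if it is at least half of that, then strong
  induction on \<open>s\<close> shows that \<open>2a\<^sub>s\<close> is \<open>2\<^sup>s\<close> or \<open>2\<^sup>s + 2\<^sup>q\<close> with \<open>q \<le> s\<close>. A number of defect at most
  \<open>1\<close> ends a chain of that kind; the first alternative is excluded by the upper bound on
  \<open>\<ell>\<close> at powers of two, and the second gives the defect \<open>1 - log\<^sub>2 (1 + 2\<^sup>-\<^sup>k)\<close> with \<open>k = s - q\<close>.
  All these values occur, at the stable numbers \<open>2\<^sup>k + 1\<close>, and they increase to \<open>1\<close>.\<close>

subsection \<open>Chains with large entries\<close>

lemma addition_chain_step:
  assumes "addition_chain c" "0 < k" "k < length c"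
  obtains i j where "i < k" "j < k" "c ! k = c ! i + c ! j"
  using assms unfolding addition_chain_def by (metis One_nat_def Suc_leI)

lemma addition_chain_nth_0: "addition_chain c \<Longrightarrow> c ! 0 = 1"
  unfolding addition_chain_def by (metis hd_conv_nth)

lemma addition_chain_le_power:
  assumes "addition_chain c" "k < length c"
  shows "c ! k \<le> 2 ^ k"
  using assms(2)
proof (induction k rule: less_induct)
  case (less k)
  show ?case
  proof (cases "k = 0")
    case True
    then show ?thesis using addition_chain_nth_0[OF assms(1)] by simp
  next
    case False
    then obtain m where k: "k = Suc m" by (cases k) auto
    obtain i j where ij: "i < k" "j < k" "c ! k = c ! i + c ! j"
      using addition_chain_step[OF assms(1)] False less.prems by blast
    have "c ! i \<le> 2 ^ i" "c ! j \<le> 2 ^ j"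
      using less ij by auto
    moreover have "(2::nat) ^ i \<le> 2 ^ m" "(2::nat) ^ j \<le> 2 ^ m"
      using ij k by (auto intro: power_increasing)
    ultimately have "c ! k \<le> 2 * 2 ^ m" using ij by linarith
    then show ?thesis using k by simp
  qed
qed

text \<open>Both summands of \<open>c ! Suc s\<close> are at most \<open>2 ^ s\<close>, so a sum of
  \<open>2 ^ Suc s\<close> forces each to be the entry at index \<open>s\<close> itself. A chain
  that attains the maximum has therefore doubled at every earlier step.\<close>

lemma addition_chain_eq_power:
  assumes "addition_chain c" "s < length c" "c ! s = 2 ^ s" "k \<le> s"
  shows "c ! k = 2 ^ k"
  using assms(2,3,4)
proof (induction s)
  case 0
  then show ?case by simp
next
  case (Suc s)
  obtain i j where ij: "i < Suc s" "j < Suc s" "c ! Suc s = c ! i + c ! j"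
    using addition_chain_step[OF assms(1) _ Suc.prems(1)] by blast
  have le: "c ! i \<le> 2 ^ i" "c ! j \<le> 2 ^ j"
    using addition_chain_le_power[OF assms(1)] ij Suc.prems(1) by auto
  have pw: "(2::nat) ^ i \<le> 2 ^ s" "(2::nat) ^ j \<le> 2 ^ s"
    using ij by (auto intro: power_increasing)
  have "c ! i + c ! j = 2 * 2 ^ s" using ij Suc.prems(2) by simp
  with le pw have eq: "(2::nat) ^ i = 2 ^ s" "c ! i = 2 ^ i"
    by linarith+
  from eq(1) have "i = s" by simp
  with eq have "c ! s = 2 ^ s" by simp
  then show ?case using Suc by (cases "k = Suc s") auto
qed

lemma power2_le_half:
  fixes q s :: nat
  assumes "q < s"
  shows "2 * (2::nat) ^ q \<le> 2 ^ s"
  using assms power_increasing[of "Suc q" s "2::nat"] by simp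

text \<open>For \<open>r = Suc s\<close> the hypothesis says that the two summands add up to at
  least \<open>2 ^ s\<close>. Many cases allow at most \<open>2 ^ s\<close>, which gives the first
  alternative. The others need the summand at index \<open>s\<close>, and the induction hypothesis
  fixes its form. The statement is doubled so that no halves of powers occur.\<close>

lemma addition_chain_large_entry:
  assumes c: "addition_chain c" and "s < length c" "2 ^ s \<le> 2 * c ! s"
  shows "2 * c ! s = 2 ^ s \<or> (\<exists>q\<le>s. 2 * c ! s = 2 ^ s + 2 ^ q)"
  using assms(2,3)
proof (induction s rule: less_induct)
  case (less r)
  show ?case
  proof (cases r)
    case 0
    then show ?thesis using addition_chain_nth_0[OF c] by simp
  next
    case (Suc s)
    have le: "c ! k \<le> 2 ^ k" if "k < r" for k
      using addition_chain_le_power[OF c, of k] that less.prems by simp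
    obtain i0 j0 where ij0: "i0 < r" "j0 < r" "c ! r = c ! i0 + c ! j0"
      using addition_chain_step[OF c _ less.prems(1)] Suc by blast
    obtain i j where ij: "i < r" "j < r" "c ! r = c ! i + c ! j" "j \<le> i"
    proof (cases "j0 \<le> i0")
      case True then show ?thesis using that ij0 by blast
    next
      case False then show ?thesis using that[of j0 i0] ij0 by simp
    qed
    have sum: "2 ^ s \<le> c ! i + c ! j" using less.prems Suc ij by simp
    have large: "2 * c ! k = 2 ^ k \<or> (\<exists>q\<le>k. 2 * c ! k = 2 ^ k + 2 ^ q)"
      if "k < r" "2 ^ k \<le> 2 * c ! k" for k
      using less.IH[of k] that less.prems(1) by simp
    \<comment> \<open>The exponent \<open>q = k\<close> is split off: it means
      \<open>c ! k = 2 ^ k\<close>, which determines all entries before index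
      \<open>k\<close>.\<close>
    have large_cases: "2 * c ! k = 2 ^ k \<or> c ! k = 2 ^ k \<or> (\<exists>q<k. 2 * c ! k = 2 ^ k + 2 ^ q)"
      if k: "k < r" "2 ^ k \<le> 2 * c ! k" for k
      using large[OF k]
    proof (elim disjE exE conjE)
      fix q
      assume "q \<le> k" "2 * c ! k = 2 ^ k + 2 ^ q"
      then show ?thesis by (cases "q = k") auto
    qed simp
    show ?thesis
    proof (cases "i = s")
      case False
      then have *: "2 * (2::nat) ^ i \<le> 2 ^ s" "2 * (2::nat) ^ j \<le> 2 ^ s"
        using ij Suc by (auto intro!: power2_le_half)
      have "c ! i + c ! j = 2 ^ s"
        using * le[OF ij(1)] le[OF ij(2)] sum by linarith
      then show ?thesis using ij Suc by simp
    next
      case True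
      note i = this
      show ?thesis
      proof (cases "j = s")
        case True
        have "2 ^ s \<le> 2 * c ! s" using sum i True by simp
        then consider "2 * c ! s = 2 ^ s" | q where "q \<le> s" "2 * c ! s = 2 ^ s + 2 ^ q"
          using large[of s] Suc lessI by blast
        then show ?thesis
        proof cases
          case 1
          then show ?thesis using ij i True Suc by simp
        next
          case 2
          then have "2 * c ! r = 2 ^ r + 2 ^ Suc q" using ij i True Suc by simp
          with 2 Suc show ?thesis by (intro disjI2 exI[of _ "Suc q"]) simp
        qed
      next
        case False
        then have js: "j < s" using ij i by simp
        have j2: "2 * (2::nat) ^ j \<le> 2 ^ s" using js by (rule power2_le_half)
        have lej: "c ! j \<le> 2 ^ j" using le ij by simp
        have "2 ^ s \<le> 2 * c ! s" using sum i j2 lej by simp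
        then consider "2 * c ! s = 2 ^ s" | "c ! s = 2 ^ s"
          | q where "q < s" "2 * c ! s = 2 ^ s + 2 ^ q"
          using large_cases[of s] Suc lessI by blast
        then show ?thesis
        proof cases
          case 1
          then have "c ! i + c ! j = 2 ^ s" using sum i j2 lej by simp
          then show ?thesis using ij Suc by simp
        next
          case 2
          then have "c ! j = 2 ^ j"
            using addition_chain_eq_power[OF c, of s j] js less.prems(1) Suc by simp
          with 2 have "2 * c ! r = 2 ^ r + 2 ^ Suc j" using ij i Suc by simp
          then show ?thesis using ij by (intro disjI2 exI[of _ "Suc j"]) simp
        next
          case (3 q)
          then have q2: "2 * (2::nat) ^ q \<le> 2 ^ s" by (intro power2_le_half) simp
          \<comment> \<open>As \<open>c ! s\<close> is only \<open>(2 ^ s + 2 ^ q) / 2\<close>, the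
            smaller summand must also be large. This allows a second use of the induction hypothesis
            when \<open>j = s - 1\<close>.\<close>
          have cj: "2 ^ s \<le> 2 * c ! j + 2 ^ q" using sum i 3 by simp
          obtain t where t: "s = Suc t" using js by (cases s) auto
          then have s2: "(2::nat) ^ s = 2 * 2 ^ t" by simp
          have half_q: "2 * c ! r = 2 ^ r + 2 * c ! j - 2 ^ t" if "q = t"
            using 3 ij i Suc t that by simp
          show ?thesis
          proof (cases "j = t")
            case False
            then have "2 * (2::nat) ^ j \<le> 2 ^ t" using js t by (intro power2_le_half) simp
            \<comment> \<open>Here \<open>2 * c ! j\<close> is at most \<open>2 ^ t\<close>, and
              \<open>2 ^ q\<close> is too, so the doubled sum is at most
              \<open>2 ^ s + 2 * 2 ^ t = 2 * 2 ^ s\<close>.\<close>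
            then have "c ! i + c ! j = 2 ^ s"
              using cj 3(2) q2 lej s2 unfolding i by linarith
            then show ?thesis using ij Suc by simp
          next
            case True
            have "2 ^ t \<le> 2 * c ! t" using cj q2 s2 unfolding True by linarith
            moreover have "t < r" using Suc t by simp
            ultimately consider "2 * c ! t = 2 ^ t" | "c ! t = 2 ^ t"
              | u where "u < t" "2 * c ! t = 2 ^ t + 2 ^ u"
              using large_cases[of t] by blast
            then show ?thesis
            proof cases
              case 1
              then have "c ! i + c ! j = 2 ^ s"
                using 3(2) q2 s2 sum unfolding i True by linarith
              then show ?thesis using ij Suc by simp
            next
              case 2
              then have "2 * c ! r = 2 ^ r + 2 ^ q" using ij i Suc 3 t True by simp
              then show ?thesis using 3 Suc by (intro disjI2 exI[of _ q]) simp
            next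
              case (3 u)
              have u2: "2 * (2::nat) ^ u \<le> 2 ^ t" using 3 by (intro power2_le_half) simp
              show ?thesis
              proof (cases "q = t")
                \<comment> \<open>The two copies of \<open>2 ^ t\<close> merge into
                  \<open>2 ^ s\<close>, which leaves \<open>2 ^ r + 2 ^ u\<close>.\<close>
                case True
                then have "2 * c ! r = 2 ^ r + 2 ^ u" using half_q 3 \<open>j = t\<close> by simp
                then show ?thesis using 3 Suc t by (intro disjI2 exI[of _ u]) simp
              next
                case False
                then have "2 * (2::nat) ^ q \<le> 2 ^ t"
                  using \<open>q < s\<close> t by (intro power2_le_half) simp
                then have "c ! i + c ! j = 2 ^ s"
                  using 3(2) \<open>2 * c ! s = 2 ^ s + 2 ^ q\<close> u2 s2 sum
                  unfolding i \<open>j = t\<close> by linarith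
                then show ?thesis using ij Suc by simp
              qed
            qed
          qed
        qed
      qed
    qed
  qed
qed

subsection \<open>Admissible sets\<close>

lemma ell_chain:
  assumes "ell_defined A n"
  obtains c where "addition_chain c" "length c = Suc (ell A n)" "c ! ell A n = n"
proof -
  from assms have "\<exists>r. \<exists>c\<in>A. addition_chain_for n c \<and> chain_length c = r"
    unfolding ell_defined_def by blast
  then have "\<exists>c\<in>A. addition_chain_for n c \<and> chain_length c = ell A n"
    unfolding ell_def by (rule LeastI_ex)
  then obtain c where "addition_chain c" "last c = n" "length c - 1 = ell A n" "c \<noteq> []"
    by (auto simp: addition_chain_for_def chain_length_def addition_chain_def)
  then show thesis using that[of c] by (cases c rule: rev_cases) (auto simp: nth_append)
qed

lemma le_power_ell: "ell_defined A n \<Longrightarrow> n \<le> 2 ^ ell A n"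
  by (metis ell_chain addition_chain_le_power lessI)

context
  fixes A :: "nat list set"
  assumes adm: "admissible A"
begin

lemma ell_definedI: "n \<ge> 1 \<Longrightarrow> ell_defined A n"
  using adm unfolding admissible_def by blast

lemma ell_le: "n \<ge> 1 \<Longrightarrow> int (ell A n) \<le> \<lfloor>log 2 (real n)\<rfloor> + int (nu2 n) - 1"
  using adm unfolding admissible_def by blast

lemma ell_power2_mult_le: "n \<ge> 1 \<Longrightarrow> ell A (2 ^ j * n) \<le> ell A n + j"
proof (induction j)
  case (Suc j)
  have "1 \<le> 2 ^ j * n" using Suc.prems by simp
  then have "ell A (2 * (2 ^ j * n)) \<le> ell A (2 ^ j * n) + 1"
    using adm unfolding admissible_def by blast
  with Suc show ?case by (simp add: mult.assoc)
qed simp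

text \<open>The bound on \<open>ell\<close> at 1 is 0, and each doubling costs at most one
  step.\<close>

lemma ell_power2_le: "ell A (2 ^ j) \<le> j"
proof -
  have "{i. bit (1::nat) i} = {0}" by (simp add: bit_1_iff del: One_nat_def)
  then have "ell A 1 = 0" using ell_le[of 1] by (simp add: nu2_def)
  then show ?thesis using ell_power2_mult_le[of 1 j] by simp
qed

lemma ell_power2_Suc_le: "ell A (2 ^ k + 1) \<le> k + 1"
\<comment> \<open>For \<open>k = 0\<close> the number is 2, with a single binary digit 1; only for
  positive \<open>k\<close> are there two.\<close>
proof (cases "k = 0")
  case True
  then have "ell A (2 ^ k + 1) = ell A (2 ^ 1)" by (simp add: numeral_2_eq_2)
  then show ?thesis using ell_power2_le[of 1] by linarith
next
  case False
  have "bit ((2::nat) ^ k + 1) i \<longleftrightarrow> i = 0 \<or> i = k" for i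
  proof (cases i)
    case 0
    then show ?thesis using False by (simp add: bit_0)
  next
    case (Suc m)
    have "(2 ^ k + 1) div 2 = (2::nat) ^ (k - 1)"
      using False by (cases k) auto
    then show ?thesis using Suc False by (auto simp: bit_Suc bit_exp_iff)
  qed
  then have "{i. bit ((2::nat) ^ k + 1) i} = {0, k}" by auto
  then have nu: "nu2 (2 ^ k + 1) = 2" using False by (simp add: nu2_def)
  have "(2::real) ^ 1 \<le> 2 ^ k" using False by (intro power_increasing) auto
  then have "2 ^ k + 1 < (2::real) ^ (k + 1)" by simp
  then have "log 2 (2 ^ k + 1) < real (k + 1)"
    by (subst log_less_iff) (auto simp: powr_realpow[symmetric] powr_add add_pos_pos)
  then have "\<lfloor>log 2 (2 ^ k + 1)\<rfloor> < int k + 1" by (subst floor_less_iff) simp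
  then show ?thesis using ell_le[of "2 ^ k + 1"] nu by (simp add: add.commute)
qed

text \<open>Doubling gives the upper bound. The number exceeds \<open>2 ^ (j + k)\<close>, so no
  chain of length \<open>j + k\<close> reaches it. Varying \<open>j\<close> gives stability, and
  \<open>j = 0\<close> gives the defect.\<close>

lemma ell_power2_mult_power2_Suc: "ell A (2 ^ j * (2 ^ k + 1)) = j + k + 1"
proof (rule antisym)
  show "ell A (2 ^ j * (2 ^ k + 1)) \<le> j + k + 1"
    using ell_power2_mult_le[of "2 ^ k + 1" j] ell_power2_Suc_le[of k] by simp
  have "(2::nat) ^ (j + k) < 2 ^ j * (2 ^ k + 1)" by (simp add: power_add)
  moreover from this have "\<dots> \<le> 2 ^ ell A (2 ^ j * (2 ^ k + 1))"
    by (intro le_power_ell ell_definedI) linarith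
  ultimately have "(2::nat) ^ (j + k) < 2 ^ ell A (2 ^ j * (2 ^ k + 1))" by (rule less_le_trans)
  then have "j + k < ell A (2 ^ j * (2 ^ k + 1))" by (rule power_less_imp_less_exp[rotated]) simp
  then show "j + k + 1 \<le> ell A (2 ^ j * (2 ^ k + 1))" by simp
qed

lemma stable_power2_Suc: "stable A (2 ^ k + 1)"
  unfolding stable_def
  using ell_power2_mult_power2_Suc ell_power2_mult_power2_Suc[of 0 k] by simp

end

subsection \<open>The defects below one\<close>

definition binary_defect :: "nat \<Rightarrow> real" where
  "binary_defect k = 1 - log 2 (1 + (1/2) ^ k)"

text \<open>Factoring out \<open>2 ^ r\<close> leaves a logarithm that depends on
  \<open>r - q\<close> only.\<close>

lemma binary_defect_eq:
  assumes "q \<le> r" "2 * n = 2 ^ r + 2 ^ q"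
  shows "real r - log 2 (real n) = binary_defect (r - q)"
proof -
  have "2 * real n = 2 ^ r + 2 ^ q"
    using arg_cong[OF assms(2), of real] by simp
  also have "\<dots> = 2 ^ r * (1 + (1/2) ^ (r - q))"
    using assms(1) by (simp add: field_simps power_diff power_one_over)
  finally have n: "2 * real n = 2 ^ r * (1 + (1/2) ^ (r - q))" .
  have pos: "1 + (1/2) ^ (r - q) > (0::real)" by (simp add: add_pos_pos)
  have "n > 0" using assms(2) by (cases n) auto
  then have "1 + log 2 (real n) = log 2 (2 * real n)" by (simp add: log_mult)
  also have "\<dots> = real r + log 2 (1 + (1/2) ^ (r - q))"
    unfolding n using pos by (subst log_mult) (auto simp: log_nat_power)
  finally have "log 2 (real n) = real r + log 2 (1 + (1/2) ^ (r - q)) - 1" by simp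
  then show ?thesis by (simp add: binary_defect_def)
qed

lemma strict_mono_binary_defect: "strict_mono binary_defect"
proof (rule strict_monoI)
  fix x y :: nat
  assume "x < y"
  then have "(1/2) ^ y < ((1/2) ^ x :: real)" by (intro power_strict_decreasing) auto
  then have "log 2 (1 + (1/2) ^ y) < log 2 (1 + (1/2) ^ x)"
    by (intro log_less) (auto intro: add_pos_pos)
  then show "binary_defect x < binary_defect y" by (simp add: binary_defect_def)
qed

lemma binary_defect_0: "binary_defect 0 = 0"
  by (simp add: binary_defect_def)

lemma binary_defect_in: "binary_defect k \<in> {0..1}"
proof -
  have "binary_defect 0 \<le> binary_defect k"
    using strict_mono_binary_defect by (simp add: strict_mono_less_eq)
  moreover have "0 \<le> log 2 (1 + (1/2) ^ k)"
    by (subst zero_le_log_cancel_iff) (auto intro: add_pos_pos)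
  ultimately show ?thesis unfolding binary_defect_0 by (simp add: binary_defect_def)
qed

lemma binary_defect_tendsto: "binary_defect \<longlonglongrightarrow> 1"
proof -
  have "(\<lambda>k. 1 - log 2 (1 + (1/2) ^ k)) \<longlonglongrightarrow> 1 - log 2 (1 + 0)"
    by (intro tendsto_intros LIMSEQ_power_zero) auto
  then show ?thesis by (simp add: binary_defect_def[abs_def])
qed

text \<open>A strictly increasing \<open>f\<close> is an order isomorphism onto its range, so the
  order there is the image of \<open>natLeq\<close>.\<close>

lemma order_type_omega_range:
  assumes "strict_mono (f :: nat \<Rightarrow> real)"
  shows "order_type_omega (range f)"
proof -
  have "{(x, y). x \<in> range f \<and> y \<in> range f \<and> x \<le> y} = dir_image natLeq f"
    unfolding dir_image_def natLeq_def using strict_mono_less_eq[OF assms] by blast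
  moreover have "(natLeq, dir_image natLeq f) \<in> ordIso"
    using assms natLeq_Well_order
    by (intro dir_image_ordIso) (auto dest: strict_mono_imp_inj_on intro: inj_on_subset)
  ultimately show ?thesis
    unfolding order_type_omega_def by (metis ordIso_symmetric)
qed

lemma defect_power2_Suc:
  assumes "admissible A"
  shows "defect A (2 ^ k + 1) = binary_defect k"
  using binary_defect_eq[of 1 "k + 1" "2 ^ k + 1"] ell_power2_mult_power2_Suc[OF assms, of 0 k]
  by (simp add: defect_def)

text \<open>A defect of at most 1 means \<open>2 ^ ell A n \<le> 2 * n\<close>, so \<open>n\<close>
  is a large last entry of a chain of length \<open>ell A n\<close>.\<close>

lemma small_defect_is_binary:
  assumes adm: "admissible A" and "n \<ge> 1" "defect A n \<le> 1"
  shows "defect A n \<in> range binary_defect"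
proof -
  let ?r = "ell A n"
  obtain c where c: "addition_chain c" "length c = Suc ?r" "c ! ?r = n"
    using ell_chain ell_definedI[OF adm assms(2)] by blast
  have "real ?r \<le> log 2 (2 * real n)"
    using assms by (simp add: defect_def log_mult)
  then have "2 powr real ?r \<le> 2 * real n"
    using assms(2) by (simp add: le_log_iff)
  then have "real (2 ^ ?r) \<le> real (2 * n)"
    by (simp add: powr_realpow)
  then have "2 ^ ?r \<le> 2 * n" by (simp only: of_nat_le_iff)
  with addition_chain_large_entry[OF c(1), of ?r] c
  consider "2 * n = 2 ^ ?r" | q where "q \<le> ?r" "2 * n = 2 ^ ?r + 2 ^ q" by auto
  then show ?thesis
  proof cases
    case 1
    \<comment> \<open>Here \<open>n = 2 ^ m\<close> would have \<open>ell A n = m + 1\<close>,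
      against the bound \<open>m\<close>.\<close>
    with assms(2) obtain m where m: "?r = Suc m" by (cases ?r) auto
    with 1 have "n = 2 ^ m" by simp
    then show ?thesis using ell_power2_le[OF adm, of m] m by simp
  next
    case 2
    then show ?thesis using binary_defect_eq by (simp add: defect_def)
  qed
qed

lemma defects_inter_unit:
  assumes "admissible A"
  shows "defects A \<inter> {0..1} = range binary_defect"
proof
  show "defects A \<inter> {0..1} \<subseteq> range binary_defect"
    using small_defect_is_binary[OF assms] by (auto simp: defects_def)
  have "binary_defect k \<in> defects A" for k
    unfolding defects_def defect_power2_Suc[OF assms, symmetric]
    by (intro CollectI exI[of _ "2 ^ k + 1"]) simp
  then show "range binary_defect \<subseteq> defects A \<inter> {0..1}"
    using binary_defect_in by blast
qed

theorem theorem7p1: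
  fixes A :: "nat list set"
  assumes "\<forall>c\<in>A. addition_chain c"
    and "admissible A"
  shows "order_type_omega (defects A \<inter> {0..1}) \<and>
         (\<forall>r::real. r < 1 \<longrightarrow> finite (defects A \<inter> {0..r})) \<and>
         (\<forall>d \<in> defects A \<inter> {0..1}. stable_defect A d) \<and>
         order_type_omega (stable_defects A \<inter> {0..1})"
proof -
  note unit = defects_inter_unit[OF assms(2)]
  have omega: "order_type_omega (defects A \<inter> {0..1})"
    unfolding unit by (rule order_type_omega_range[OF strict_mono_binary_defect])
  \<comment> \<open>One stable witness per value suffices: \<open>2 ^ k + 1\<close> serves for
    \<open>binary_defect k\<close>, whichever number produced the defect.\<close>
  have stab: "\<forall>d \<in> defects A \<inter> {0..1}. stable_defect A d"
    unfolding unit stable_defect_def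
    using stable_power2_Suc[OF assms(2)] defect_power2_Suc[OF assms(2)] by (metis imageE)
  have "stable_defects A \<subseteq> defects A"
    by (auto simp: stable_defects_def stable_defect_def stable_def defects_def)
  with stab have "stable_defects A \<inter> {0..1} = defects A \<inter> {0..1}"
    by (auto simp: stable_defects_def)
  moreover have "finite (defects A \<inter> {0..r})" if "r < 1" for r
  proof -
    \<comment> \<open>Since the values tend to 1, only those with index below \<open>N\<close> can
      be at most \<open>r\<close>.\<close>
    obtain N where N: "\<And>k. k \<ge> N \<Longrightarrow> r < binary_defect k"
      using order_tendstoD(1)[OF binary_defect_tendsto \<open>r < 1\<close>]
      by (auto simp: eventually_sequentially)
    have "defects A \<inter> {0..r} \<subseteq> range binary_defect \<inter> {..r}"
      using unit \<open>r < 1\<close> by auto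
    also have "\<dots> \<subseteq> binary_defect ` {..<N}"
      using N by (fastforce simp: not_less[symmetric])
    finally show ?thesis by (rule finite_subset) simp
  qed
  ultimately show ?thesis using omega stab by simp
qed

end
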